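(* Let $d$ be even, let $\Gamma\subseteq\mathrm{Sym}(N)$ be a permutation group and let $v,\bar v\in\mathcal{S}_d(\Gamma)$ be irreducible arrangements. Then $v$ and $\bar v$ are deformation equivalent if and only if their representations are positively isomorphic.
   Context: Let $n,d\ge 1$ and $N=\{1,\dots,n\}$. A $d$-dimensional arrangement is a family of points $v_i\in\mathbb{R}^d$, $i\in N$; its matrix $M\in\mathbb{R}^{n\times d}$ has $i$-th row $v_i^\top$. It is normalized if $M^\top M=\mathrm{Id}$. For a permutation group $\Gamma\subseteq\mathrm{Sym}(N)$, $v$ is a $\Gamma$-arrangement if there is a group homomorphism $T\colon\Gamma\to\mathrm{O}(\mathbb{R}^d)$ with $T_\phi v_i=v_{\phi(i)}$ for all $i\in N$, $\phi\in\Gamma$; $T$ is called the representation of $v$ (it is unique if the $v_i$ span $\mathbb{R}^d$, in particular if $v$ is normalized). $v$ is irreducible if its representation is irreducible over $\mathbb{R}$. Two representations $T,\bar T\colon\Gamma\to\mathrm{O}(\mathbb{R}^d)$ are positively isomorphic if there is an equivariant map between them, i.e. $R\in\mathbb{R}^{d\times d}$ with $RT_\phi=\bar T_\phi R$ for all $\phi\in\Gamma$, with $\det R>0$. $\mathcal{S}_d(\Gamma)$ is the set of $d$-dimensional normalized $\Gamma$-arrangements on $N$, with the subspace topology from $(\mathbb{R}^d)^n$. Two arrangements $v,\bar v\in\mathcal{S}_d(\Gamma)$ are deformation equivalent if there is a continuous map $v(\cdot)\colon[0,1]\to\mathcal{S}_d(\Gamma)$ with $v(0)=v$ and $v(1)=\bar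 v$. *)

theory Defs
  imports "HOL-Analysis.Analysis" "HOL-Algebra.Bij"
begin

text \<open>
  The index set \<open>N\<close> is the finite type \<open>'n\<close>, so that \<open>Sym(N)\<close> is \<^term>\<open>BijGroup (UNIV :: 'n set)\<close>,
  and \<open>d\<close> is \<open>CARD('d)\<close>. A family of points \<open>v\<^sub>i\<close> is a value of type \<^typ>\<open>real^'d^'n\<close>: its points are
  \<open>v $ i\<close>, and as a matrix it has these points as rows, so it is its own arrangement matrix \<open>M\<close>.
  The topology of this type is the product topology of \<open>(R\<^sup>d)\<^sup>n\<close>.
\<close>

definition normalized :: "real^'d^'n \<Rightarrow> bool" where
  "normalized v \<longleftrightarrow> transpose v ** v = mat 1"

definition orthogonal_group :: "(real^'d^'d) monoid" where
  "orthogonal_group = \<lparr>carrier = {Q. orthogonal_matrix Q}, mult = (**), one = mat 1\<rparr>"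

lemma group_orthogonal_group: "group (orthogonal_group :: (real^'d^'d) monoid)"
proof (rule groupI)
  fix Q :: "real^'d^'d"
  assume "Q \<in> carrier orthogonal_group"
  then show "\<exists>P\<in>carrier orthogonal_group. P \<otimes>\<^bsub>orthogonal_group\<^esub> Q = \<one>\<^bsub>orthogonal_group\<^esub>"
    by (intro bexI[of _ "transpose Q"]) (auto simp: orthogonal_group_def orthogonal_matrix_def)
qed (auto simp: orthogonal_group_def orthogonal_matrix_mul orthogonal_matrix_id matrix_mul_assoc)

definition orthogonal_rep :: "('n \<Rightarrow> 'n) set \<Rightarrow> (('n \<Rightarrow> 'n) \<Rightarrow> real^'d^'d) \<Rightarrow> bool" where
  "orthogonal_rep \<Gamma> T \<longleftrightarrow> T \<in> hom ((BijGroup UNIV)\<lparr>carrier := \<Gamma>\<rparr>) orthogonal_group"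

definition represents :: "('n \<Rightarrow> 'n) set \<Rightarrow> real^'d^'n \<Rightarrow> (('n \<Rightarrow> 'n) \<Rightarrow> real^'d^'d) \<Rightarrow> bool" where
  "represents \<Gamma> v T \<longleftrightarrow> orthogonal_rep \<Gamma> T \<and> (\<forall>\<phi>\<in>\<Gamma>. \<forall>i. T \<phi> *v (v $ i) = v $ \<phi> i)"

definition is_arrangement :: "('n \<Rightarrow> 'n) set \<Rightarrow> real^'d^'n \<Rightarrow> bool" where
  "is_arrangement \<Gamma> v \<longleftrightarrow> (\<exists>T. represents \<Gamma> v T)"

definition normalized_arrangements :: "('n \<Rightarrow> 'n) set \<Rightarrow> (real^'d^'n) set" where
  "normalized_arrangements \<Gamma> = {v. is_arrangement \<Gamma> v \<and> normalized v}"

text \<open>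
  Representations are functions on all of \<^typ>\<open>'n \<Rightarrow> 'n\<close>, while only their values on \<open>\<Gamma>\<close> matter;
  extensionality fixes the others. The description is meaningful for arrangements whose points span,
  in particular for normalized ones, see \<open>represents_representation_of\<close>.
\<close>

definition representation_of :: "('n \<Rightarrow> 'n) set \<Rightarrow> real^'d^'n \<Rightarrow> (('n \<Rightarrow> 'n) \<Rightarrow> real^'d^'d)" where
  "representation_of \<Gamma> v = (THE T. T \<in> extensional \<Gamma> \<and> represents \<Gamma> v T)"

lemma represents_unique:
  fixes v :: "real^'d^'n"
  assumes "normalized v" "represents \<Gamma> v T" "represents \<Gamma> v T'" "\<phi> \<in> \<Gamma>"
  shows "T \<phi> = T' \<phi>"
proof -
  have "S \<phi> ** transpose v = transpose (\<chi> i. v $ \<phi> i)" if "represents \<Gamma> v S" for S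
    using that assms(4)
    by (simp add: represents_def vec_eq_iff matrix_matrix_mult_def matrix_vector_mult_def transpose_def)
  then have "T \<phi> ** transpose v ** v = T' \<phi> ** transpose v ** v"
    using assms by metis
  then show ?thesis
    using assms(1) by (simp add: normalized_def flip: matrix_mul_assoc)
qed

lemma represents_representation_of:
  fixes v :: "real^'d^'n"
  assumes "subgroup \<Gamma> (BijGroup UNIV)" "v \<in> normalized_arrangements \<Gamma>"
  shows "representation_of \<Gamma> v \<in> extensional \<Gamma> \<and> represents \<Gamma> v (representation_of \<Gamma> v)"
  unfolding representation_of_def
proof (rule theI'[where P = "\<lambda>T. T \<in> extensional \<Gamma> \<and> represents \<Gamma> v T"])
  obtain T where T: "represents \<Gamma> v T" and v: "normalized v"
    using assms(2) by (auto simp: normalized_arrangements_def is_arrangement_def)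
  have "represents \<Gamma> v (restrict T \<Gamma>)"
    using T subgroup.m_closed[OF assms(1)]
    by (auto simp: represents_def orthogonal_rep_def hom_def)
  moreover have "T1 = T2"
    if "T1 \<in> extensional \<Gamma> \<and> represents \<Gamma> v T1" "T2 \<in> extensional \<Gamma> \<and> represents \<Gamma> v T2" for T1 T2
    using that represents_unique[OF v] by (intro extensionalityI[of T1 \<Gamma> T2]) auto
  ultimately show "\<exists>!T. T \<in> extensional \<Gamma> \<and> represents \<Gamma> v T"
    by (metis restrict_extensional)
qed

definition irreducible_rep :: "('n \<Rightarrow> 'n) set \<Rightarrow> (('n \<Rightarrow> 'n) \<Rightarrow> real^'d^'d) \<Rightarrow> bool" where
  "irreducible_rep \<Gamma> T \<longleftrightarrow>
     (\<forall>W. subspace W \<and> (\<forall>\<phi>\<in>\<Gamma>. \<forall>w\<in>W. T \<phi> *v w \<in> W) \<longrightarrow> W = {0} \<or> W = UNIV)"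

definition irreducible_arrangement :: "('n \<Rightarrow> 'n) set \<Rightarrow> real^'d^'n \<Rightarrow> bool" where
  "irreducible_arrangement \<Gamma> v \<longleftrightarrow> irreducible_rep \<Gamma> (representation_of \<Gamma> v)"

definition positively_isomorphic ::
    "('n \<Rightarrow> 'n) set \<Rightarrow> (('n \<Rightarrow> 'n) \<Rightarrow> real^'d^'d) \<Rightarrow> (('n \<Rightarrow> 'n) \<Rightarrow> real^'d^'d) \<Rightarrow> bool" where
  "positively_isomorphic \<Gamma> T T' \<longleftrightarrow> (\<exists>R. (\<forall>\<phi>\<in>\<Gamma>. R ** T \<phi> = T' \<phi> ** R) \<and> det R > 0)"

definition deformation_equivalent ::
    "('n \<Rightarrow> 'n) set \<Rightarrow> real^'d^'n \<Rightarrow> real^'d^'n \<Rightarrow> bool" where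
  "deformation_equivalent \<Gamma> v w \<longleftrightarrow> path_component (normalized_arrangements \<Gamma>) v w"

end

theory Submission
  imports Defs
begin

text \<open>
  A deformation cannot change the positive isomorphism class of the representation. For a normalized
  arrangement \<open>v\<close> the representing matrices are polynomial in \<open>v\<close> (\<open>representation_formula\<close>), and
  \<open>\<Sum>\<^sub>\<phi> T\<^sub>\<phi> S\<^sub>\<phi>\<^sup>T\<close> intertwines any two orthogonal representations \<open>S\<close> and \<open>T\<close>
  (\<open>averaged_intertwiner\<close>). For \<open>T = S\<close> this sum is a positive multiple of the identity, so its
  determinant stays positive when \<open>T\<close> is the representation of a nearby arrangement. Hence positive
  isomorphism is an equivalence relation with open classes, and a path stays within one class.

  Conversely, everything rests on a form of Schur's lemma (\<open>irreducible_invariant_norm\<close>): a linear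
  map \<open>f\<close> for which \<open>\<bar>f x\<bar>\<close> is invariant under an irreducible representation multiplies all lengths
  by the same constant. Applied to an intertwiner of positive determinant, it shows that the
  intertwiner is a multiple of a rotation \<open>Q\<close>. The rotation group is connected, because orthogonal
  matrices are products of reflections, so \<open>v\<close> can be deformed into the arrangement \<open>u\<close> with
  points \<open>Q v\<^sub>i\<close>, which has the same representation as \<open>w\<close>. Applied to the arrangement matrices
  on the segment from \<open>u\<close> to \<open>w\<close>, the lemma shows that each of them is a multiple of a normalized
  arrangement, so rescaling turns the segment into a deformation. This fails only if the segment
  passes through the zero matrix, that is, if \<open>w = - u\<close>; then \<open>-1\<close>, which is a rotation since \<open>d\<close>
  is even, is joined to the identity and carries \<open>u\<close> to \<open>w\<close>.
\<close>

section \<open>Matrices\<close>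

lemma inner_matrix_vector_transpose:
  fixes A :: "real^'a^'b"
  shows "(A *v x) \<bullet> y = x \<bullet> (transpose A *v y)"
  by (metis dot_lmul_matrix inner_commute vector_transpose_matrix)

lemma orthogonal_matrix_inner:
  fixes Q :: "real^'d^'d"
  assumes "orthogonal_matrix Q"
  shows "(Q *v x) \<bullet> (Q *v y) = x \<bullet> y"
  using assms
  by (simp add: inner_matrix_vector_transpose orthogonal_matrix_def matrix_vector_mul_assoc)

lemma orthogonal_matrix_norm:
  fixes Q :: "real^'d^'d"
  assumes "orthogonal_matrix Q"
  shows "norm (Q *v x) = norm x"
  using orthogonal_matrix_inner[OF assms] by (simp add: norm_eq_sqrt_inner)

text \<open>
  By polarization, the Gram condition says that the arrangement matrix is an isometric embedding of
  \<open>R\<^sup>d\<close> into \<open>R\<^sup>n\<close>. This is the form in which Schur's lemma produces normalized arrangements.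
\<close>

lemma normalized_iff_norm:
  fixes v :: "real^'d^'n"
  shows "normalized v \<longleftrightarrow> (\<forall>x. norm (v *v x) = norm x)"
proof
  assume "normalized v"
  then show "\<forall>x. norm (v *v x) = norm x"
    by (simp add: normalized_def norm_eq_sqrt_inner inner_matrix_vector_transpose
        matrix_vector_mul_assoc)
next
  assume nrm: "\<forall>x. norm (v *v x) = norm x"
  have "x \<bullet> ((transpose v ** v) *v y) = x \<bullet> y" for x y
  proof -
    have "x \<bullet> ((transpose v ** v) *v y) = (v *v x) \<bullet> (v *v y)"
      by (simp add: inner_matrix_vector_transpose matrix_vector_mul_assoc)
    also have "\<dots> = x \<bullet> y"
      unfolding dot_norm using nrm by (simp flip: matrix_vector_right_distrib)
    finally show ?thesis .
  qed
  then have "(transpose v ** v) *v y = mat 1 *v y" for y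
    by (metis matrix_vector_mul_lid vector_eq_ldot)
  then show "normalized v"
    unfolding normalized_def matrix_eq by blast
qed

lemma sum_matrix_mult_left:
  fixes A :: "real^'b^'c" and f :: "'a \<Rightarrow> real^'e^'b"
  shows "A ** sum f I = (\<Sum>i\<in>I. A ** f i)"
  by (induction I rule: infinite_finite_induct) (auto simp: matrix_add_ldistrib)

lemma sum_matrix_mult_right:
  fixes A :: "real^'e^'b" and f :: "'a \<Rightarrow> real^'b^'c"
  shows "sum f I ** A = (\<Sum>i\<in>I. f i ** A)"
  by (induction I rule: infinite_finite_induct)
     (auto simp: vec_eq_iff matrix_matrix_mult_def distrib_right sum.distrib)

lemma continuous_on_matrix_mult [continuous_intros]:
  fixes f :: "'a::topological_space \<Rightarrow> real^'b^'c" and g :: "'a \<Rightarrow> real^'e^'b"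
  assumes "continuous_on S f" "continuous_on S g"
  shows "continuous_on S (\<lambda>x. f x ** g x)"
  unfolding matrix_matrix_mult_def by (intro continuous_intros assms)

lemma continuous_on_matrix_transpose [continuous_intros]:
  fixes f :: "'a::topological_space \<Rightarrow> real^'b^'c"
  assumes "continuous_on S f"
  shows "continuous_on S (\<lambda>x. transpose (f x))"
  unfolding transpose_def by (intro continuous_intros assms)

lemma continuous_on_det_real [continuous_intros]:
  fixes f :: "'a::topological_space \<Rightarrow> real^'b^'b"
  assumes "continuous_on S f"
  shows "continuous_on S (\<lambda>x. det (f x))"
  unfolding det_def by (intro continuous_intros assms)

section \<open>Rotations are joined to the identity\<close>

text \<open>
  For a unit vector \<open>a\<close> this is the reflection in the hyperplane orthogonal to \<open>a\<close>. Being polynomial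
  in \<open>a\<close>, it turns paths on the unit sphere into paths of reflections.
\<close>

definition householder :: "real^'d \<Rightarrow> real^'d^'d" where
  "householder a = (\<chi> i j. (if i = j then 1 else 0) - 2 * a $ i * a $ j)"

lemma householder_vector: "householder a *v x = x - (2 * (a \<bullet> x)) *\<^sub>R a"
proof -
  have "(householder a *v x) $ i = x $ i - 2 * (a \<bullet> x) * a $ i" for i
  proof -
    have "(householder a *v x) $ i
        = (\<Sum>j\<in>UNIV. (if i = j then x $ j else 0) - 2 * a $ i * (a $ j * x $ j))"
      by (auto simp: householder_def matrix_vector_mult_def algebra_simps intro!: sum.cong)
    also have "\<dots> = x $ i - 2 * a $ i * (a \<bullet> x)"
      by (simp add: sum_subtractf sum_distrib_left[symmetric] inner_vec_def)
    finally show ?thesis by simp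
  qed
  then show ?thesis by (simp add: vec_eq_iff)
qed

lemma householder_involution:
  assumes "norm a = 1"
  shows "householder a ** householder a = mat 1"
proof -
  have "a \<bullet> a = 1"
    using assms by (simp add: norm_eq_1)
  then have "(householder a ** householder a) *v x = mat 1 *v x" for x
    by (simp add: householder_vector inner_diff_right flip: matrix_vector_mul_assoc)
  then show ?thesis
    unfolding matrix_eq by blast
qed

lemma orthogonal_householder:
  assumes "norm a = 1"
  shows "orthogonal_matrix (householder a)"
proof -
  have "transpose (householder a) = householder a"
    by (simp add: householder_def transpose_def vec_eq_iff)
  then show ?thesis
    using householder_involution[OF assms] by (simp add: orthogonal_matrix_def)
qed

text \<open>
  All reflections are conjugate under orthogonal matrices, and the one along a coordinate axis is
  diagonal with a single entry \<open>-1\<close>.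
\<close>

lemma det_householder:
  fixes a :: "real^'d"
  assumes "norm a = 1"
  shows "det (householder a) = -1"
proof -
  fix k :: 'd
  obtain A where A: "orthogonal_matrix A" "A *v axis k 1 = a"
    using orthogonal_matrix_exists_basis[OF assms] .
  have "(householder a ** A) *v x = (A ** householder (axis k 1)) *v x" for x
  proof -
    have "a \<bullet> (A *v x) = axis k 1 \<bullet> x"
      using orthogonal_matrix_inner[OF A(1)] A(2) by metis
    then show ?thesis
      using A(2)
      by (simp add: householder_vector matrix_vector_mult_diff_distrib matrix_vector_mult_scaleR
          flip: matrix_vector_mul_assoc)
  qed
  then have "householder a ** A = A ** householder (axis k 1)"
    unfolding matrix_eq by blast
  then have "det (householder a) * det A = det A * det (householder (axis k 1 :: real^'d))"
    by (metis det_mul)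
  moreover have "det A \<noteq> 0"
    using det_orthogonal_matrix[OF A(1)] by auto
  moreover have "det (householder (axis k 1 :: real^'d)) = -1"
  proof -
    have "det (householder (axis k 1 :: real^'d))
        = (\<Prod>i\<in>UNIV. householder (axis k 1 :: real^'d) $ i $ i)"
      by (rule det_diagonal) (auto simp: householder_def axis_def)
    also have "\<dots> = (\<Prod>i\<in>UNIV. if i = k then -1 else 1)"
      by (intro prod.cong) (auto simp: householder_def axis_def)
    finally show ?thesis by simp
  qed
  ultimately show ?thesis
    by (metis mult.commute mult_left_cancel)
qed

text \<open>
  The induction step of the Cartan-Dieudonne theorem. If \<open>Q\<close> moves \<open>x\<close>, the reflection that exchanges
  \<open>x\<close> and \<open>Q x\<close> makes \<open>x\<close> a fixed point of the product. The old fixed points survive, because they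
  are orthogonal to the mirror normal \<open>Q x - x\<close>.
\<close>

lemma householder_fixes_more:
  fixes Q :: "real^'d^'d"
  assumes Q: "orthogonal_matrix Q" and "Q \<noteq> mat 1"
  obtains a where "norm a = 1"
    and "dim {x. Q *v x = x} < dim {x. (householder a ** Q) *v x = x}"
proof -
  obtain x where x: "Q *v x \<noteq> x"
    using assms(2) by (metis matrix_eq matrix_vector_mul_lid)
  define r where "r = norm (Q *v x - x)"
  define a where "a = (1 / r) *\<^sub>R (Q *v x - x)"
  have r: "r > 0" using x by (simp add: r_def)
  have a: "norm a = 1" using r by (simp add: a_def r_def)
  have fixed: "(householder a ** Q) *v y = y" if y: "Q *v y = y" for y
  proof -
    have "(Q *v x - x) \<bullet> y = 0"
      using orthogonal_matrix_inner[OF Q, of x y] y by (simp add: inner_diff_left)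
    then have "a \<bullet> y = 0" by (simp add: a_def)
    then show ?thesis
      by (simp add: householder_vector y flip: matrix_vector_mul_assoc)
  qed
  have new: "(householder a ** Q) *v x = x"
  proof -
    have "(Q *v x) \<bullet> (Q *v x) = x \<bullet> x"
      by (rule orthogonal_matrix_inner[OF Q])
    then have "2 * ((Q *v x - x) \<bullet> (Q *v x)) = r\<^sup>2"
      by (simp add: r_def power2_norm_eq_inner inner_diff_left inner_diff_right inner_commute)
    then have "2 * (a \<bullet> (Q *v x)) = r"
      using r by (simp add: a_def power2_eq_square)
    then show ?thesis
      using r by (simp add: householder_vector a_def flip: matrix_vector_mul_assoc)
  qed
  have sub: "subspace {y. A *v y = y}" for A :: "real^'d^'d"
    by (auto simp: subspace_def matrix_vector_right_distrib matrix_vector_mult_scaleR)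
  have "{y. Q *v y = y} \<subset> {y. (householder a ** Q) *v y = y}"
    using fixed new x by blast
  then have "dim {y. Q *v y = y} < dim {y. (householder a ** Q) *v y = y}"
    by (intro dim_psubset) (simp add: span_eq_iff[THEN iffD2, OF sub])
  with a that show thesis by blast
qed

lemma path_component_matrix_mult:
  fixes P Q A :: "real^'d^'d"
  assumes "path_component {Q. orthogonal_matrix Q} P Q" "orthogonal_matrix A"
  shows "path_component {Q. orthogonal_matrix Q} (A ** P) (A ** Q)"
    and "path_component {Q. orthogonal_matrix Q} (P ** A) (Q ** A)"
proof -
  obtain g where g: "path g" "path_image g \<subseteq> {Q. orthogonal_matrix Q}"
    "pathstart g = P" "pathfinish g = Q"
    using assms(1) by (auto simp: path_component_def)
  show "path_component {Q. orthogonal_matrix Q} (A ** P) (A ** Q)"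
    unfolding path_component_def
    using g assms(2)
    by (intro exI[of _ "\<lambda>t. A ** g t"])
       (auto simp: path_def path_image_def pathstart_def pathfinish_def
          intro!: continuous_intros orthogonal_matrix_mul)
  show "path_component {Q. orthogonal_matrix Q} (P ** A) (Q ** A)"
    unfolding path_component_def
    using g assms(2)
    by (intro exI[of _ "\<lambda>t. g t ** A"])
       (auto simp: path_def path_image_def pathstart_def pathfinish_def
          intro!: continuous_intros orthogonal_matrix_mul)
qed

text \<open>This is where the dimension must be at least two: the unit sphere has to be connected.\<close>

lemma path_component_householder:
  fixes a b :: "real^'d"
  assumes "2 \<le> CARD('d)" "norm a = 1" "norm b = 1"
  shows "path_component {Q. orthogonal_matrix Q} (householder a) (householder b)"
proof -
  have "path_connected (sphere (0::real^'d) 1)"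
    using assms(1) by (intro path_connected_sphere) simp
  moreover have "a \<in> sphere 0 1" "b \<in> sphere 0 1"
    using assms by simp_all
  ultimately obtain g where g: "path g" "path_image g \<subseteq> sphere 0 1"
    "pathstart g = a" "pathfinish g = b"
    unfolding path_connected_def by blast
  then show ?thesis
    unfolding path_component_def
    by (intro exI[of _ "\<lambda>t. householder (g t)"])
       (auto simp: path_def path_image_def pathstart_def pathfinish_def householder_def
          intro!: continuous_intros orthogonal_householder[unfolded householder_def])
qed

text \<open>
  Write \<open>Q\<close> as a product of reflections. Each factor can be deformed into the fixed reflection
  \<open>householder e\<close>, and two adjacent copies of it cancel, so only the parity of the number of factors
  remains; the determinant detects it. Carrying the determinant through the induction rules out that
  a rotation lands in the component of the reflections.
\<close>

lemma orthogonal_matrix_component: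
  fixes Q :: "real^'d^'d" and e :: "real^'d"
  assumes "2 \<le> CARD('d)" "norm e = 1" "orthogonal_matrix Q"
  shows "det Q = 1 \<and> path_component {Q. orthogonal_matrix Q} (mat 1) Q \<or>
         det Q = -1 \<and> path_component {Q. orthogonal_matrix Q} (householder e) Q"
  using assms(3)
proof (induction "CARD('d) - dim {x. Q *v x = x}" arbitrary: Q rule: less_induct)
  case less
  let ?O = "{Q :: real^'d^'d. orthogonal_matrix Q}"
  show ?case
  proof (cases "Q = mat 1")
    case True
    then show ?thesis
      by (simp add: path_component_refl orthogonal_matrix_id)
  next
    case False
    then obtain a where a: "norm a = 1"
      and dim: "dim {x. Q *v x = x} < dim {x. (householder a ** Q) *v x = x}"
      using householder_fixes_more[OF less.prems] by blast
    define P where "P = householder a ** Q"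
    have P: "orthogonal_matrix P"
      by (simp add: P_def a less.prems orthogonal_householder orthogonal_matrix_mul)
    have Q: "Q = householder a ** P"
      by (simp add: P_def matrix_mul_assoc householder_involution[OF a])
    have "dim {x. P *v x = x} \<le> CARD('d)"
      using dim_subset_UNIV[of "{x. P *v x = x}"] by simp
    then have "CARD('d) - dim {x. P *v x = x} < CARD('d) - dim {x. Q *v x = x}"
      using dim by (simp add: P_def)
    note IH = less.hyps[OF this P]
    have detQ: "det Q = - det P"
      by (simp add: Q det_mul det_householder[OF a])
    have ea: "path_component ?O (householder e) (householder a)"
      by (rule path_component_householder[OF assms(1,2) a])
    from IH show ?thesis
    proof
      assume *: "det P = 1 \<and> path_component ?O (mat 1) P"
      then have "path_component ?O (householder a) Q"
        using path_component_matrix_mult(1)[OF _ orthogonal_householder[OF a], of "mat 1" P]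
        by (simp add: Q)
      with ea have "path_component ?O (householder e) Q"
        by (rule path_component_trans)
      with * detQ show ?thesis by simp
    next
      assume *: "det P = -1 \<and> path_component ?O (householder e) P"
      have "path_component ?O (mat 1) (householder a ** householder e)"
        using path_component_matrix_mult(2)[OF ea orthogonal_householder[OF assms(2)]]
        by (simp add: householder_involution[OF assms(2)])
      moreover have "path_component ?O (householder a ** householder e) Q"
        using path_component_matrix_mult(1)[OF _ orthogonal_householder[OF a]] *
        by (simp add: Q)
      ultimately have "path_component ?O (mat 1) Q"
        by (rule path_component_trans)
      with * detQ show ?thesis by simp
    qed
  qed
qed

lemma rotation_matrix_path_component_id:
  fixes Q :: "real^'d^'d"
  assumes "2 \<le> CARD('d)" "rotation_matrix Q"
  shows "path_component {Q. orthogonal_matrix Q} (mat 1) Q"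
  using orthogonal_matrix_component[OF assms(1), of "axis undefined 1" Q] assms(2)
  by (auto simp: rotation_matrix_def norm_axis_1)

section \<open>Representations\<close>

lemma orthogonal_rep_orthogonal:
  assumes "orthogonal_rep \<Gamma> T" "\<phi> \<in> \<Gamma>"
  shows "orthogonal_matrix (T \<phi>)"
  using assms by (auto simp: orthogonal_rep_def hom_def orthogonal_group_def)

lemma permutation_group_closed:
  assumes "subgroup \<Gamma> (BijGroup UNIV)" "\<phi> \<in> \<Gamma>" "\<psi> \<in> \<Gamma>"
  shows "bij \<phi>" and "\<phi> \<circ> \<psi> \<in> \<Gamma>"
    and "orthogonal_rep \<Gamma> T \<Longrightarrow> T (\<phi> \<circ> \<psi>) = T \<phi> ** T \<psi>"
proof -
  have B: "\<phi> \<in> Bij UNIV" "\<psi> \<in> Bij UNIV"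
    using assms subgroup.subset[OF assms(1)] by (auto simp: BijGroup_def)
  have m: "\<phi> \<otimes>\<^bsub>BijGroup UNIV\<^esub> \<psi> = \<phi> \<circ> \<psi>"
    using B by (auto simp: BijGroup_def compose_def fun_eq_iff)
  show "bij \<phi>" using B by (simp add: Bij_def)
  show "\<phi> \<circ> \<psi> \<in> \<Gamma>"
    using subgroup.m_closed[OF assms] by (simp add: m)
  show "T (\<phi> \<circ> \<psi>) = T \<phi> ** T \<psi>" if "orthogonal_rep \<Gamma> T"
  proof -
    have "T (\<phi> \<otimes>\<^bsub>BijGroup UNIV\<^esub> \<psi>) = T \<phi> ** T \<psi>"
      using that assms(2,3) by (simp add: orthogonal_rep_def hom_def orthogonal_group_def)
    then show ?thesis by (simp add: m)
  qed
qed

text \<open>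
  A version of Schur's lemma that needs no eigenvalues. Let \<open>c\<close> be the maximum of \<open>\<bar>f x\<bar>\<close> on the unit
  sphere. The quadratic form \<open>c\<^sup>2 \<bar>x\<bar>\<^sup>2 - \<bar>f x\<bar>\<^sup>2\<close> is positive semidefinite, hence its zero set is a
  subspace. It is invariant and contains a maximizer, so by irreducibility it is the whole space.
\<close>

lemma irreducible_invariant_norm:
  fixes f :: "real^'d \<Rightarrow> 'b::real_inner"
  assumes lin: "linear f" and irr: "irreducible_rep \<Gamma> T" and rep: "orthogonal_rep \<Gamma> T"
    and inv: "\<And>\<phi> x. \<phi> \<in> \<Gamma> \<Longrightarrow> norm (f (T \<phi> *v x)) = norm (f x)"
  obtains c where "c \<ge> 0" "\<And>x. norm (f x) = c * norm x"
proof -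
  have "continuous_on (sphere 0 1) (\<lambda>x. norm (f x))"
    using lin by (intro continuous_intros linear_continuous_on) (simp add: linear_conv_bounded_linear)
  moreover have "(axis undefined 1 :: real^'d) \<in> sphere 0 1"
    by (simp add: norm_axis_1)
  ultimately obtain u where u: "norm u = 1" and max: "\<And>x. norm x = 1 \<Longrightarrow> norm (f x) \<le> norm (f u)"
    using continuous_attains_sup[OF compact_sphere, of "0::real^'d" 1 "\<lambda>x. norm (f x)"]
    by (auto simp: dist_norm)
  define c where "c = norm (f u)"
  have le: "norm (f x) \<le> c * norm x" for x
  proof (cases "x = 0")
    case True
    then show ?thesis using lin by (simp add: linear_0)
  next
    case False
    then have "norm (f ((1 / norm x) *\<^sub>R x)) \<le> c"
      unfolding c_def by (intro max) simp
    then show ?thesis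
      using False lin by (simp add: linear_scale field_simps)
  qed
  define W where "W = {x. norm (f x) = c * norm x}"
  have W_iff: "x \<in> W \<longleftrightarrow> (norm (f x))\<^sup>2 = c\<^sup>2 * (norm x)\<^sup>2" for x
    unfolding W_def mem_Collect_eq power_mult_distrib[symmetric]
    by (rule power2_eq_iff_nonneg[symmetric]) (auto simp: c_def)
  have le2: "(norm (f x))\<^sup>2 \<le> c\<^sup>2 * (norm x)\<^sup>2" for x
    using power_mono[OF le[of x], of 2] by (simp add: power_mult_distrib)
  have par: "(norm (x + y))\<^sup>2 + (norm (x - y))\<^sup>2 = 2 * (norm x)\<^sup>2 + 2 * (norm y)\<^sup>2"
    for x y :: "'z::real_inner"
    by (simp add: power2_norm_eq_inner inner_simps inner_commute)
  \<comment> \<open>A nonnegative quadratic form that vanishes at \<open>x\<close> and \<open>y\<close> also vanishes at \<open>x + y\<close>, since by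
    the parallelogram law its values at \<open>x + y\<close> and \<open>x - y\<close> add up to zero.\<close>
  have "x + y \<in> W" if "x \<in> W" "y \<in> W" for x y
  proof -
    have "(norm (f (x + y)))\<^sup>2 + (norm (f (x - y)))\<^sup>2 = 2 * (norm (f x))\<^sup>2 + 2 * (norm (f y))\<^sup>2"
      using lin par[of "f x" "f y"] by (simp add: linear_add linear_diff)
    also have "\<dots> = c\<^sup>2 * (2 * (norm x)\<^sup>2 + 2 * (norm y)\<^sup>2)"
      using that by (simp add: W_iff algebra_simps)
    also have "\<dots> = c\<^sup>2 * (norm (x + y))\<^sup>2 + c\<^sup>2 * (norm (x - y))\<^sup>2"
      by (simp add: par[symmetric] algebra_simps)
    finally show ?thesis
      using le2[of "x + y"] le2[of "x - y"] by (simp add: W_iff)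
  qed
  then have "subspace W"
    using lin by (auto simp: subspace_def W_def linear_0 linear_scale)
  moreover have "\<forall>\<phi>\<in>\<Gamma>. \<forall>x\<in>W. T \<phi> *v x \<in> W"
    using inv orthogonal_matrix_norm[OF orthogonal_rep_orthogonal[OF rep]]
    by (simp add: W_def)
  moreover have "u \<in> W" "u \<noteq> 0"
    using u by (auto simp: W_def c_def)
  ultimately have "W = UNIV"
    using irr unfolding irreducible_rep_def by blast
  then have "norm (f x) = c * norm x" for x
    by (auto simp: W_def)
  then show thesis
    by (rule that[rotated]) (simp add: c_def)
qed

section \<open>Arrangements\<close>

text \<open>
  The coordinates of \<open>v x\<close> are the inner products of \<open>x\<close> with the points, and applying \<open>T\<^sub>\<phi>\<close> to \<open>x\<close>
  only permutes them. This supplies the invariance hypothesis of Schur's lemma.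
\<close>

lemma represents_norm_invariant:
  fixes v :: "real^'d^'n"
  assumes "subgroup \<Gamma> (BijGroup UNIV)" "represents \<Gamma> v T" "\<phi> \<in> \<Gamma>"
  shows "norm (v *v (T \<phi> *v x)) = norm (v *v x)"
proof -
  have bij: "bij \<phi>"
    using assms by (blast intro: permutation_group_closed)
  have "(v *v (T \<phi> *v x)) $ \<phi> i = (v *v x) $ i" for i
  proof -
    have "(v *v (T \<phi> *v x)) $ \<phi> i = (T \<phi> *v v $ i) \<bullet> (T \<phi> *v x)"
      using assms by (simp add: represents_def matrix_vector_mul_component)
    also have "\<dots> = v $ i \<bullet> x"
      using assms
      by (intro orthogonal_matrix_inner orthogonal_rep_orthogonal) (auto simp: represents_def)
    finally show ?thesis by (simp add: matrix_vector_mul_component)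
  qed
  then have "(\<Sum>i\<in>UNIV. ((v *v (T \<phi> *v x)) $ \<phi> i)\<^sup>2) = (\<Sum>i\<in>UNIV. ((v *v x) $ i)\<^sup>2)"
    by simp
  then show ?thesis
    using sum.reindex_bij_betw[OF bij, of "\<lambda>i. ((v *v (T \<phi> *v x)) $ i)\<^sup>2"]
    by (simp add: norm_vec_def L2_set_def)
qed

lemma represents_combination:
  fixes v w :: "real^'d^'n"
  assumes "represents \<Gamma> v T" "represents \<Gamma> w T"
  shows "represents \<Gamma> (a *\<^sub>R v + b *\<^sub>R w) T"
  using assms by (simp add: represents_def matrix_vector_right_distrib matrix_vector_mult_scaleR)

text \<open>
  The rows of \<open>v ** transpose Q\<close> are the points \<open>Q v\<^sub>i\<close>.
\<close>

lemma represents_rotate: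
  fixes v :: "real^'d^'n"
  assumes "represents \<Gamma> v T" "orthogonal_rep \<Gamma> T'" "\<And>\<phi>. \<phi> \<in> \<Gamma> \<Longrightarrow> Q ** T \<phi> = T' \<phi> ** Q"
  shows "represents \<Gamma> (v ** transpose Q) T'"
proof -
  have row: "(v ** transpose Q) $ i = Q *v v $ i" for i
    by (simp add: vec_eq_iff matrix_matrix_mult_def matrix_vector_mult_def transpose_def mult.commute)
  have "T' \<phi> *v (Q *v v $ i) = Q *v v $ \<phi> i" if "\<phi> \<in> \<Gamma>" for \<phi> i
    using assms(1) assms(3)[OF that] that
    by (metis represents_def matrix_vector_mul_assoc)
  then show ?thesis
    using assms(2) by (simp add: represents_def row)
qed

lemma normalized_rotate:
  fixes v :: "real^'d^'n"
  assumes "normalized v" "orthogonal_matrix Q"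
  shows "normalized (v ** transpose Q)"
  using assms orthogonal_matrix_norm[of "transpose Q"]
  by (simp add: normalized_iff_norm flip: matrix_vector_mul_assoc)

lemma normalized_arrangements_rotate:
  fixes v :: "real^'d^'n"
  assumes \<Gamma>: "subgroup \<Gamma> (BijGroup UNIV)" and v: "v \<in> normalized_arrangements \<Gamma>"
    and Q: "orthogonal_matrix Q"
  shows "v ** transpose Q \<in> normalized_arrangements \<Gamma>"
proof -
  obtain T where T: "represents \<Gamma> v T" and n: "normalized v"
    using v by (auto simp: normalized_arrangements_def is_arrangement_def)
  define T' where "T' \<phi> = Q ** T \<phi> ** transpose Q" for \<phi>
  have rep: "orthogonal_rep \<Gamma> T"
    using T by (simp add: represents_def)
  have QQ: "transpose Q ** Q = mat 1"
    using Q by (simp add: orthogonal_matrix_def)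
  have cancel: "transpose Q ** (Q ** A) = A" for A
    by (simp add: matrix_mul_assoc QQ)
  have "orthogonal_rep \<Gamma> T'"
    using rep Q
    by (auto simp: orthogonal_rep_def hom_def orthogonal_group_def T'_def Pi_def
        orthogonal_matrix_mul cancel simp flip: matrix_mul_assoc)
  moreover have "Q ** T \<phi> = T' \<phi> ** Q" for \<phi>
    by (simp add: T'_def QQ flip: matrix_mul_assoc)
  ultimately have "represents \<Gamma> (v ** transpose Q) T'"
    using represents_rotate[OF T] by blast
  then show ?thesis
    using normalized_rotate[OF n Q]
    by (auto simp: normalized_arrangements_def is_arrangement_def)
qed

lemma path_component_rotate:
  fixes v :: "real^'d^'n"
  assumes "2 \<le> CARD('d)" "subgroup \<Gamma> (BijGroup UNIV)" "v \<in> normalized_arrangements \<Gamma>"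
    and "rotation_matrix Q"
  shows "path_component (normalized_arrangements \<Gamma>) v (v ** transpose Q)"
proof -
  obtain g where g: "path g" "path_image g \<subseteq> {Q. orthogonal_matrix Q}"
    "pathstart g = mat 1" "pathfinish g = Q"
    using rotation_matrix_path_component_id[OF assms(1,4)] by (auto simp: path_component_def)
  then show ?thesis
    unfolding path_component_def
    by (intro exI[of _ "\<lambda>t. v ** transpose (g t)"])
       (auto simp: path_def path_image_def pathstart_def pathfinish_def
          intro!: continuous_intros normalized_arrangements_rotate[OF assms(2,3)])
qed

text \<open>
  The arrangements with representation \<open>T\<close> form a linear space, and by Schur's lemma its nonzero
  elements become normalized after rescaling. So the normalized ones form a sphere in it, on which
  two points that are not antipodal are joined by the rescaled segment.
\<close>

lemma path_component_same_representation:
  fixes v w :: "real^'d^'n"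
  assumes \<Gamma>: "subgroup \<Gamma> (BijGroup UNIV)" and irr: "irreducible_rep \<Gamma> T"
    and v: "represents \<Gamma> v T" "normalized v" and w: "represents \<Gamma> w T" "normalized w"
    and "w \<noteq> - v"
  shows "path_component (normalized_arrangements \<Gamma>) v w"
proof -
  define e :: "real^'d" where "e = axis undefined 1"
  define p where "p t = (1 - t) *\<^sub>R v + t *\<^sub>R w" for t
  define q where "q t = norm (p t *v e)" for t
  have e: "norm e = 1" by (simp add: e_def norm_axis_1)
  have rep: "represents \<Gamma> (p t) T" for t
    unfolding p_def by (rule represents_combination[OF v(1) w(1)])
  have norm_p: "norm (p t *v x) = q t * norm x" for t x
  proof -
    obtain c where "\<And>x. norm (p t *v x) = c * norm x"
      using irreducible_invariant_norm[of "(*v) (p t)", OF _ irr _ represents_norm_invariant[OF \<Gamma> rep]]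
        rep[of t] by (metis matrix_vector_mul_linear represents_def)
    then show ?thesis by (simp add: q_def e)
  qed
  have p0: "p t \<noteq> 0" if "t \<in> {0..1}" for t
  proof
    assume "p t = 0"
    then have eq: "(1 - t) *\<^sub>R v = - (t *\<^sub>R w)"
      by (simp add: p_def eq_neg_iff_add_eq_0)
    \<comment> \<open>Both matrices preserve the length of \<open>e\<close>, so the segment can meet zero only at its midpoint.\<close>
    then have "norm (((1 - t) *\<^sub>R v) *v e) = norm ((- (t *\<^sub>R w)) *v e)"
      by simp
    then have "1 - t = t"
      using v(2) w(2) that e
      by (simp add: normalized_iff_norm scaleR_matrix_vector_assoc[symmetric]
          flip: scaleR_minus_left)
    then have "t = 1/2" by simp
    then have "(1/2) *\<^sub>R v = (1/2) *\<^sub>R (- w)"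
      using eq unfolding \<open>t = 1/2\<close> by simp
    then have "v = - w"
      by (subst (asm) scaleR_cancel_left) simp
    with \<open>w \<noteq> - v\<close> show False by simp
  qed
  have q0: "q t > 0" if "t \<in> {0..1}" for t
  proof -
    have "q t \<noteq> 0"
    proof
      assume "q t = 0"
      then have "p t *v x = 0 *v x" for x
        using norm_p[of t x] by simp
      then have "p t = 0" unfolding matrix_eq by blast
      with p0[OF that] show False by simp
    qed
    then show ?thesis by (simp add: q_def)
  qed
  have "(1 / q t) *\<^sub>R p t \<in> normalized_arrangements \<Gamma>" if "t \<in> {0..1}" for t
  proof -
    have "represents \<Gamma> ((1 / q t) *\<^sub>R p t) T"
      using represents_combination[OF rep[of t] rep[of t], of "1 / q t" 0] by simp
    moreover have "normalized ((1 / q t) *\<^sub>R p t)"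
      using q0[OF that] norm_p[of t]
      by (simp add: normalized_iff_norm scaleR_matrix_vector_assoc[symmetric])
    ultimately show ?thesis
      by (auto simp: normalized_arrangements_def is_arrangement_def)
  qed
  moreover have "continuous_on {0..1} (\<lambda>t. (1 / q t) *\<^sub>R p t)"
  proof -
    have p: "continuous_on {0..1} p"
      unfolding p_def by (intro continuous_intros)
    then have "continuous_on {0..1} q"
      unfolding q_def matrix_vector_mult_def by (intro continuous_intros)
    with p show ?thesis
      using q0 by (intro continuous_intros) force+
  qed
  moreover have "q 0 = 1" "q 1 = 1"
    using v(2) w(2) e by (simp_all add: q_def p_def normalized_iff_norm)
  ultimately show ?thesis
    unfolding path_component_def
    by (intro exI[of _ "\<lambda>t. (1 / q t) *\<^sub>R p t"])
       (auto simp: path_def path_image_def pathstart_def pathfinish_def p_def)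
qed

section \<open>Positive isomorphism along deformations\<close>

lemma positively_isomorphic_sym:
  assumes "positively_isomorphic \<Gamma> S T"
  shows "positively_isomorphic \<Gamma> T S"
proof -
  obtain R where R: "\<And>\<phi>. \<phi> \<in> \<Gamma> \<Longrightarrow> R ** S \<phi> = T \<phi> ** R" and det: "det R > 0"
    using assms by (auto simp: positively_isomorphic_def)
  obtain L where L: "R ** L = mat 1" "L ** R = mat 1"
    using det invertible_det_nz[of R] by (auto simp: invertible_def)
  have "L ** T \<phi> = S \<phi> ** L" if "\<phi> \<in> \<Gamma>" for \<phi>
  proof -
    have "L ** T \<phi> = L ** (T \<phi> ** R) ** L"
      by (simp add: L flip: matrix_mul_assoc)
    also have "\<dots> = S \<phi> ** L"
      by (simp add: R[OF that, symmetric] matrix_mul_assoc L)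
    finally show ?thesis .
  qed
  moreover have "det R * det L = 1"
    by (metis L(1) det_I det_mul)
  then have "det L > 0"
    using det by (metis zero_less_mult_pos zero_less_one)
  ultimately show ?thesis
    by (auto simp: positively_isomorphic_def)
qed

lemma positively_isomorphic_trans:
  assumes "positively_isomorphic \<Gamma> S T" "positively_isomorphic \<Gamma> T U"
  shows "positively_isomorphic \<Gamma> S U"
proof -
  obtain P R where P: "\<And>\<phi>. \<phi> \<in> \<Gamma> \<Longrightarrow> P ** S \<phi> = T \<phi> ** P" "det P > 0"
    and R: "\<And>\<phi>. \<phi> \<in> \<Gamma> \<Longrightarrow> R ** T \<phi> = U \<phi> ** R" "det R > 0"
    using assms by (auto simp: positively_isomorphic_def)
  have "(R ** P) ** S \<phi> = U \<phi> ** (R ** P)" if "\<phi> \<in> \<Gamma>" for \<phi>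
    by (metis P(1) R(1) matrix_mul_assoc that)
  moreover have "det (R ** P) > 0"
    using P R by (simp add: det_mul)
  ultimately show ?thesis
    by (auto simp: positively_isomorphic_def)
qed

text \<open>
  Averaging \<open>T\<^sub>\<phi> A S\<^sub>\<phi>\<^sup>-\<^sup>1\<close> over the group turns every matrix \<open>A\<close> into an intertwiner; here \<open>A\<close> is the
  identity, and the factor \<open>1/|\<Gamma>|\<close> is omitted.
\<close>

lemma averaged_intertwiner:
  fixes S T :: "('n::finite \<Rightarrow> 'n) \<Rightarrow> real^'d^'d"
  assumes \<Gamma>: "subgroup \<Gamma> (BijGroup UNIV)" and S: "orthogonal_rep \<Gamma> S" and T: "orthogonal_rep \<Gamma> T"
    and \<psi>: "\<psi> \<in> \<Gamma>"
  shows "(\<Sum>\<phi>\<in>\<Gamma>. T \<phi> ** transpose (S \<phi>)) ** S \<psi> = T \<psi> ** (\<Sum>\<phi>\<in>\<Gamma>. T \<phi> ** transpose (S \<phi>))"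
proof -
  have "inj_on (\<lambda>\<phi>. \<psi> \<circ> \<phi>) \<Gamma>"
    using permutation_group_closed(1)[OF \<Gamma> \<psi> \<psi>]
    by (auto simp: inj_on_def fun_eq_iff bij_def dest: injD)
  moreover have "(\<lambda>\<phi>. \<psi> \<circ> \<phi>) ` \<Gamma> \<subseteq> \<Gamma>"
    using permutation_group_closed(2)[OF \<Gamma> \<psi>] by blast
  ultimately have bij: "bij_betw (\<lambda>\<phi>. \<psi> \<circ> \<phi>) \<Gamma> \<Gamma>"
    by (simp add: bij_betw_def endo_inj_surj)
  have "(\<Sum>\<phi>\<in>\<Gamma>. T \<phi> ** transpose (S \<phi>)) ** S \<psi>
      = (\<Sum>\<phi>\<in>\<Gamma>. T (\<psi> \<circ> \<phi>) ** transpose (S (\<psi> \<circ> \<phi>))) ** S \<psi>"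
    by (simp add: sum.reindex_bij_betw[OF bij, of "\<lambda>\<phi>. T \<phi> ** transpose (S \<phi>)"])
  also have "\<dots> = (\<Sum>\<phi>\<in>\<Gamma>. T \<psi> ** (T \<phi> ** transpose (S \<phi>)))"
  proof -
    have "transpose (S \<psi>) ** S \<psi> = mat 1"
      using orthogonal_rep_orthogonal[OF S \<psi>] by (simp add: orthogonal_matrix_def)
    then have "T (\<psi> \<circ> \<phi>) ** transpose (S (\<psi> \<circ> \<phi>)) ** S \<psi> = T \<psi> ** (T \<phi> ** transpose (S \<phi>))"
      if "\<phi> \<in> \<Gamma>" for \<phi>
      using permutation_group_closed(3)[OF \<Gamma> \<psi> that S] permutation_group_closed(3)[OF \<Gamma> \<psi> that T]
      by (simp add: matrix_transpose_mul flip: matrix_mul_assoc)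
    then show ?thesis by (simp add: sum_matrix_mult_right)
  qed
  also have "\<dots> = T \<psi> ** (\<Sum>\<phi>\<in>\<Gamma>. T \<phi> ** transpose (S \<phi>))"
    by (simp add: sum_matrix_mult_left)
  finally show ?thesis .
qed

text \<open>
  The formula makes the representation a continuous function of the normalized arrangement.
\<close>

lemma representation_formula:
  fixes v :: "real^'d^'n"
  assumes "normalized v" "represents \<Gamma> v T" "\<phi> \<in> \<Gamma>"
  shows "T \<phi> = transpose (\<chi> i. v $ \<phi> i) ** v"
proof -
  have "T \<phi> ** transpose v = transpose (\<chi> i. v $ \<phi> i)"
    using assms(2,3)
    by (simp add: represents_def vec_eq_iff matrix_matrix_mult_def matrix_vector_mult_def transpose_def)
  then show ?thesis
    using assms(1) by (metis normalized_def matrix_mul_assoc matrix_mul_rid)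
qed

text \<open>
  The neighbourhood of \<open>a\<close> on which the averaged intertwiner from the representation of \<open>a\<close> has
  positive determinant lies in the positive isomorphism class of \<open>a\<close>; a connected set on which all
  classes are open meets only one of them.
\<close>

lemma deformation_imp_positively_isomorphic:
  fixes v w :: "real^'d^'n"
  assumes \<Gamma>: "subgroup \<Gamma> (BijGroup UNIV)"
    and path: "path_component (normalized_arrangements \<Gamma>) v w"
  shows "positively_isomorphic \<Gamma> (representation_of \<Gamma> v) (representation_of \<Gamma> w)"
proof -
  let ?\<rho> = "representation_of \<Gamma> :: real^'d^'n \<Rightarrow> _"
  obtain g where g: "path g" "path_image g \<subseteq> normalized_arrangements \<Gamma>"
    "pathstart g = v" "pathfinish g = w"
    using path by (auto simp: path_component_def)
  show ?thesis
  proof (rule connected_equivalence_relation[of "path_image g" v w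
        "\<lambda>x y. positively_isomorphic \<Gamma> (?\<rho> x) (?\<rho> y)"])
    show "connected (path_image g)" using g by (simp add: connected_path_image)
    show "v \<in> path_image g" "w \<in> path_image g" using g by auto
    fix a assume "a \<in> path_image g"
    then have a: "a \<in> normalized_arrangements \<Gamma>" using g by blast
    have rep: "represents \<Gamma> x (?\<rho> x)" "normalized x" "orthogonal_rep \<Gamma> (?\<rho> x)"
      if "x \<in> normalized_arrangements \<Gamma>" for x
      using represents_representation_of[OF \<Gamma> that] that
      by (auto simp: normalized_arrangements_def represents_def)
    define F where "F x = (\<Sum>\<phi>\<in>\<Gamma>. ?\<rho> x \<phi> ** transpose (?\<rho> a \<phi>))" for x
    define U where "U = {x \<in> path_image g. det (F x) > 0}"
    have "continuous_on (path_image g) (\<lambda>x. ?\<rho> x \<phi>)" if "\<phi> \<in> \<Gamma>" for \<phi>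
    proof -
      have "continuous_on (path_image g) (\<lambda>x. transpose (\<chi> i. x $ \<phi> i) ** x)"
        by (intro continuous_intros)
      then show ?thesis
        by (rule continuous_on_eq) (use g rep that representation_formula in \<open>metis subsetD\<close>)
    qed
    then have "continuous_on (path_image g) (\<lambda>x. det (F x))"
      unfolding F_def by (intro continuous_intros)
    then have "openin (top_of_set (path_image g)) U"
      unfolding U_def
      using continuous_openin_preimage_gen[of _ "\<lambda>x. det (F x)" "{0<..}"]
      by (simp add: vimage_def Int_def)
    moreover have "a \<in> U"
    proof -
      have "F a = (\<Sum>\<phi>\<in>\<Gamma>. mat 1)"
        unfolding F_def using orthogonal_rep_orthogonal[OF rep(3)[OF a]]
        by (intro sum.cong) (auto simp: orthogonal_matrix_def)
      then have "F a = mat (real (card \<Gamma>))"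
        by (simp add: vec_eq_iff mat_def sum_component del: sum_constant) simp
      moreover have "card \<Gamma> > 0"
        using subgroup.one_closed[OF \<Gamma>] by (auto simp: card_gt_0_iff)
      ultimately have "det (F a) > 0"
        by (simp add: det_diagonal mat_def)
      then show ?thesis
        using \<open>a \<in> path_image g\<close> by (simp add: U_def)
    qed
    moreover have "positively_isomorphic \<Gamma> (?\<rho> a) (?\<rho> x)" if "x \<in> U" for x
    proof -
      have "x \<in> normalized_arrangements \<Gamma>" "det (F x) > 0"
        using that g by (auto simp: U_def)
      then show ?thesis
        unfolding positively_isomorphic_def F_def
        using averaged_intertwiner[OF \<Gamma> rep(3)[OF a] rep(3)] by blast
    qed
    ultimately show "\<exists>T. openin (top_of_set (path_image g)) T \<and> a \<in> T \<and>
        (\<forall>x\<in>T. positively_isomorphic \<Gamma> (?\<rho> a) (?\<rho> x))"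
      by blast
  qed (blast intro: positively_isomorphic_sym positively_isomorphic_trans)+
qed

section \<open>From positive isomorphism to a deformation\<close>

text \<open>
  An intertwiner \<open>R\<close> satisfies \<open>\<bar>R S\<^sub>\<phi> x\<bar> = \<bar>T\<^sub>\<phi> R x\<bar> = \<bar>R x\<bar>\<close>, so Schur's lemma makes it a multiple
  of an isometry; the sign of the determinant makes the isometry a rotation.
\<close>

lemma positive_intertwiner_rotation:
  fixes S T :: "('n \<Rightarrow> 'n) \<Rightarrow> real^'d^'d"
  assumes irr: "irreducible_rep \<Gamma> S" and S: "orthogonal_rep \<Gamma> S" and T: "orthogonal_rep \<Gamma> T"
    and "positively_isomorphic \<Gamma> S T"
  obtains Q where "rotation_matrix Q" "\<And>\<phi>. \<phi> \<in> \<Gamma> \<Longrightarrow> Q ** S \<phi> = T \<phi> ** Q"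
proof -
  obtain R where R: "\<And>\<phi>. \<phi> \<in> \<Gamma> \<Longrightarrow> R ** S \<phi> = T \<phi> ** R" and det: "det R > 0"
    using assms(4) by (auto simp: positively_isomorphic_def)
  have "norm (R *v (S \<phi> *v x)) = norm (R *v x)" if "\<phi> \<in> \<Gamma>" for \<phi> x
    using R[OF that] orthogonal_matrix_norm[OF orthogonal_rep_orthogonal[OF T that]]
    by (metis matrix_vector_mul_assoc)
  then obtain c where c: "c \<ge> 0" "\<And>x. norm (R *v x) = c * norm x"
    using irreducible_invariant_norm[OF matrix_vector_mul_linear irr S, of R] by blast
  have "c \<noteq> 0"
  proof
    assume "c = 0"
    then have "R *v x = 0 *v x" for x
      using c(2)[of x] by simp
    then have "R = 0" unfolding matrix_eq by blast
    then have "R = mat 0" by (simp add: mat_def vec_eq_iff)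
    then have "det R = 0" by (simp only: det_0)
    with det show False by simp
  qed
  with c have c0: "c > 0" by simp
  define Q where "Q = (1 / c) *\<^sub>R R"
  have "normalized Q"
    using c0 c(2) by (simp add: normalized_iff_norm Q_def scaleR_matrix_vector_assoc[symmetric])
  then have orth: "orthogonal_matrix Q"
    by (simp add: normalized_def orthogonal_matrix)
  have "Q = mat (1 / c) ** R"
    by (simp add: Q_def matrix_matrix_mult_def mat_def vec_eq_iff if_distrib[of "\<lambda>x. x * _"] cong: if_cong)
  then have "det Q = (1 / c) ^ CARD('d) * det R"
    by (simp add: det_mul det_diagonal mat_def)
  then have "det Q > 0"
    using c0 det by simp
  then have "rotation_matrix Q"
    using orth det_orthogonal_matrix[OF orth] by (auto simp: rotation_matrix_def)
  moreover have "Q ** S \<phi> = T \<phi> ** Q" if "\<phi> \<in> \<Gamma>" for \<phi>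
    using R[OF that] by (simp add: Q_def scalar_matrix_assoc[symmetric] matrix_scalar_ac)
  ultimately show thesis using that by blast
qed

lemma positively_isomorphic_imp_deformation:
  fixes v w :: "real^'d^'n"
  assumes even: "even CARD('d)" and \<Gamma>: "subgroup \<Gamma> (BijGroup UNIV)"
    and v: "v \<in> normalized_arrangements \<Gamma>" and w: "w \<in> normalized_arrangements \<Gamma>"
    and irr_v: "irreducible_arrangement \<Gamma> v" and irr_w: "irreducible_arrangement \<Gamma> w"
    and iso: "positively_isomorphic \<Gamma> (representation_of \<Gamma> v) (representation_of \<Gamma> w)"
  shows "path_component (normalized_arrangements \<Gamma>) v w"
proof -
  let ?S = "representation_of \<Gamma> v" and ?T = "representation_of \<Gamma> w"
  let ?A = "normalized_arrangements \<Gamma> :: (real^'d^'n) set"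
  have card: "2 \<le> CARD('d)"
    using even by (metis One_nat_def Suc_leI dvd_imp_le numeral_2_eq_2 zero_less_card_finite)
  have S: "represents \<Gamma> v ?S" and T: "represents \<Gamma> w ?T"
    using represents_representation_of[OF \<Gamma>] v w by auto
  have irr: "irreducible_rep \<Gamma> ?S" "irreducible_rep \<Gamma> ?T"
    using irr_v irr_w by (auto simp: irreducible_arrangement_def)
  have reps: "orthogonal_rep \<Gamma> ?S" "orthogonal_rep \<Gamma> ?T"
    using S T by (auto simp: represents_def)
  obtain Q where Q: "rotation_matrix Q" "\<And>\<phi>. \<phi> \<in> \<Gamma> \<Longrightarrow> Q ** ?S \<phi> = ?T \<phi> ** Q"
    using positive_intertwiner_rotation[OF irr(1) reps iso] by blast
  define u where "u = v ** transpose Q"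
  have u: "u \<in> ?A"
    unfolding u_def using Q(1)
    by (intro normalized_arrangements_rotate[OF \<Gamma> v]) (simp add: rotation_matrix_def)
  have uT: "represents \<Gamma> u ?T"
    unfolding u_def by (rule represents_rotate[OF S reps(2) Q(2)])
  have "path_component ?A v u"
    unfolding u_def by (rule path_component_rotate[OF card \<Gamma> v Q(1)])
  moreover have "path_component ?A u w"
  proof (cases "w = - u")
    case True
    \<comment> \<open>For antipodal arrangements the matrix \<open>-1\<close>, a rotation in even dimension, replaces the segment.\<close>
    have "rotation_matrix (mat (-1) :: real^'d^'d)"
    proof -
      have "mat (-1) ** (mat (-1) :: real^'d^'d) = mat 1"
        by (simp add: matrix_matrix_mult_def mat_def vec_eq_iff if_distrib[of "\<lambda>x. x * _"] cong: if_cong)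
      moreover have "det (mat (-1) :: real^'d^'d) = 1"
        using even by (simp add: det_diagonal mat_def)
      ultimately show ?thesis
        by (simp add: rotation_matrix_def orthogonal_matrix)
    qed
    moreover have "u ** transpose (mat (-1)) = w"
      unfolding True transpose_mat
      by (simp add: matrix_matrix_mult_def mat_def vec_eq_iff if_distrib[of "\<lambda>x. _ * x"] cong: if_cong)
    ultimately show ?thesis
      using path_component_rotate[OF card \<Gamma> u] by metis
  next
    case False
    then show ?thesis
      using u w by (intro path_component_same_representation[OF \<Gamma> irr(2) uT _ T])
        (auto simp: normalized_arrangements_def)
  qed
  ultimately show ?thesis
    by (rule path_component_trans)
qed

theorem theorem5p8:
  fixes \<Gamma> :: "('n::finite \<Rightarrow> 'n) set" and v w :: "real^'d::finite^'n"
  assumes "even CARD('d)"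
    and "subgroup \<Gamma> (BijGroup UNIV)"
    and "v \<in> normalized_arrangements \<Gamma>" and "w \<in> normalized_arrangements \<Gamma>"
    and "irreducible_arrangement \<Gamma> v" and "irreducible_arrangement \<Gamma> w"
  shows "deformation_equivalent \<Gamma> v w \<longleftrightarrow>
         positively_isomorphic \<Gamma> (representation_of \<Gamma> v) (representation_of \<Gamma> w)"
  unfolding deformation_equivalent_def
  using deformation_imp_positively_isomorphic[OF assms(2)]
    positively_isomorphic_imp_deformation[OF assms] by blast

end
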